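(* Let $\mathcal{B}=\{B_k(x)\}_{k=0}^\infty$, where $B_k$ is the $k$-th univariate Bell polynomial, given by the recurrence $$B_{k+1}(x)=x\bigl(B_k(x)+DB_k(x)\bigr),\qquad k\in\mathbb{N},$$ with initial value $B_0(x)=1$. Then $\mathscr{T}_k(\mathcal{B};x)$ is weakly Hurwitz stable for every $k\in\mathbb{N}$.
   Context: $\mathbb{N}=\{0,1,2,\dots\}$ and $D=\partial/\partial x$ denotes differentiation with respect to $x$. For a sequence of polynomials $\mathcal{P}=\{P_k\}_{k=0}^\infty$, the $k$-th Turán expression is $$\mathscr{T}_k(\mathcal{P};x)=(P_{k+1}(x))^2-P_{k+2}(x)P_k(x),\qquad k\in\mathbb{N}.$$ A polynomial in $\mathbb{C}[x]$ is called weakly Hurwitz stable if it is non-zero at every $x\in\mathbb{C}$ with $\operatorname{Re} x>0$. *)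

theory Defs
  imports Complex_Main "HOL-Computational_Algebra.Polynomial"
begin

primrec bell_poly :: "nat \<Rightarrow> complex poly" where
  "bell_poly 0 = 1"
| "bell_poly (Suc k) = [:0, 1:] * (bell_poly k + pderiv (bell_poly k))"

definition turan :: "(nat \<Rightarrow> 'a::comm_ring_1 poly) \<Rightarrow> nat \<Rightarrow> 'a poly" where
  "turan P k = (P (k + 1))\<^sup>2 - P (k + 2) * P k"

definition weakly_hurwitz_stable :: "complex poly \<Rightarrow> bool" where
  "weakly_hurwitz_stable p \<longleftrightarrow> (\<forall>z. Re z > 0 \<longrightarrow> poly p z \<noteq> 0)"

end

theory Submission
  imports Defs "HOL-Computational_Algebra.Fundamental_Theorem_Algebra"
begin

text \<open>
  If f is a polynomial whose zeros are real numbers \<open>-a\<close> with \<open>a \<ge> 0\<close> and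
  \<open>T f = x (f + f')\<close>, then \<open>(T f)\<^sup>2 - f T (T f) = - x f\<^sup>2 (1 + \<Sum> a / (x + a)\<^sup>2)\<close>.
  For x in the open first quadrant every summand with \<open>a > 0\<close> has negative imaginary part, for
  x in the open fourth quadrant positive imaginary part, and for positive real x every summand is
  nonnegative; so the last factor does not vanish. That the Bell polynomials have only
  nonpositive real zeros follows because T preserves this property, again by looking at
  imaginary parts, this time of \<open>f' / f = \<Sum> 1 / (x + a)\<close>.
\<close>

text \<open>The entries are the negated roots with multiplicity, so nonpositive real roots become
  \<open>a \<ge> 0\<close>; a list allows induction on the linear factors.\<close>

definition real_roots_poly :: "complex \<Rightarrow> real list \<Rightarrow> complex poly" where
  "real_roots_poly c as = smult c (\<Prod>a\<leftarrow>as. [:of_real a, 1:])"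

lemma real_roots_poly_Nil: "real_roots_poly c [] = [:c:]"
  by (simp add: real_roots_poly_def)

lemma real_roots_poly_Cons:
  "real_roots_poly c (a # as) = [:of_real a, 1:] * real_roots_poly c as"
  by (simp add: real_roots_poly_def)

lemma poly_real_roots_poly_Cons:
  "poly (real_roots_poly c (a # as)) z = (z + of_real a) * poly (real_roots_poly c as) z"
  by (simp add: real_roots_poly_Cons algebra_simps)

lemma poly_pderiv_real_roots_poly_Cons:
  "poly (pderiv (real_roots_poly c (a # as))) z =
    poly (real_roots_poly c as) z + (z + of_real a) * poly (pderiv (real_roots_poly c as)) z"
  by (simp add: real_roots_poly_Cons pderiv_add pderiv_pCons pderiv_smult algebra_simps)

lemma poly_real_roots_poly_eq_0_iff:
  "poly (real_roots_poly c as) z = 0 \<longleftrightarrow> c = 0 \<or> (\<exists>a\<in>set as. z + of_real a = 0)"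
  by (induction as) (auto simp: real_roots_poly_Nil poly_real_roots_poly_Cons)

lemma poly_pderiv_real_roots_poly:
  assumes "poly (real_roots_poly c as) z \<noteq> 0"
  shows "poly (pderiv (real_roots_poly c as)) z =
    poly (real_roots_poly c as) z * (\<Sum>a\<leftarrow>as. 1 / (z + of_real a))"
  using assms
proof (induction as)
  case (Cons a as)
  then have "z + of_real a \<noteq> 0" "poly (real_roots_poly c as) z \<noteq> 0"
    by (auto simp: poly_real_roots_poly_eq_0_iff)
  with Cons.IH show ?case
    by (simp add: poly_pderiv_real_roots_poly_Cons poly_real_roots_poly_Cons distrib_left)
qed (simp add: real_roots_poly_Nil pderiv_pCons)

text \<open>Differentiating \<open>f' / f\<close>, the sum of the \<open>1 / (z + a)\<close>, and
  multiplying by \<open>- f^2\<close> gives this identity.\<close>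

lemma poly_laguerre_real_roots_poly:
  fixes c as
  defines "f \<equiv> real_roots_poly c as"
  assumes "poly f z \<noteq> 0"
  shows "(poly (pderiv f) z)\<^sup>2 - poly f z * poly (pderiv (pderiv f)) z =
    (poly f z)\<^sup>2 * (\<Sum>a\<leftarrow>as. 1 / (z + of_real a)\<^sup>2)"
  using assms(2) unfolding f_def
proof (induction as)
  case (Cons a as)
  define g where "g = real_roots_poly c as"
  let ?w = "z + of_real a"
  have w: "?w \<noteq> 0" and g: "poly g z \<noteq> 0"
    using Cons.prems by (auto simp: g_def poly_real_roots_poly_eq_0_iff)
  \<comment> \<open>For \<open>f = w g\<close> with \<open>w' = 1\<close>, the mixed terms
    \<open>2 w g g'\<close> in \<open>f'^2\<close> and \<open>f f''\<close> cancel.\<close>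
  have "(poly (pderiv (real_roots_poly c (a # as))) z)\<^sup>2
      - poly (real_roots_poly c (a # as)) z
        * poly (pderiv (pderiv (real_roots_poly c (a # as)))) z
    = (poly g z)\<^sup>2 + ?w\<^sup>2 * ((poly (pderiv g) z)\<^sup>2 - poly g z * poly (pderiv (pderiv g)) z)"
    by (simp add: real_roots_poly_Cons flip: g_def)
      (simp add: pderiv_pCons pderiv_add pderiv_smult power2_eq_square algebra_simps)
  also have "\<dots> = (?w * poly g z)\<^sup>2 * (1 / ?w\<^sup>2 + (\<Sum>a\<leftarrow>as. 1 / (z + of_real a)\<^sup>2))"
    using Cons.IH g w unfolding g_def by (simp add: power_mult_distrib distrib_left)
  finally show ?case
    by (simp add: poly_real_roots_poly_Cons g_def)
qed (simp add: real_roots_poly_Nil pderiv_pCons)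

lemma real_roots_poly_exhaust:
  assumes "p \<noteq> 0" and "\<And>z. poly p z = 0 \<Longrightarrow> z \<in> \<real> \<and> Re z \<le> 0"
  obtains c as where "c \<noteq> 0" "\<forall>a\<in>set as. a \<ge> 0" "p = real_roots_poly c as"
proof -
  obtain root where root: "smult (lead_coeff p) (\<Prod>i<degree p. [:- root i, 1:]) = p"
    using complex_poly_decompose' .
  define as where "as = map (\<lambda>i. - Re (root i)) [0..<degree p]"
  have "z \<in> \<real> \<and> Re z \<le> 0" if "i < degree p" "z = root i" for i z
  proof -
    have "poly (smult (lead_coeff p) (\<Prod>i<degree p. [:- root i, 1:])) z = 0"
      using that by (auto simp: poly_prod)
    then show ?thesis
      using assms(2) unfolding root by blast
  qed
  then have roots: "Re (root i) \<le> 0" "of_real (Re (root i)) = root i" if "i < degree p" for i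
    using that by (auto simp: complex_is_Real_iff complex_eq_iff)
  have "p = real_roots_poly (lead_coeff p) as"
    by (subst root[symmetric])
      (auto simp: real_roots_poly_def as_def o_def roots prod.list_conv_set_nth
        atLeast0LessThan intro!: prod.cong)
  moreover have "\<forall>a\<in>set as. a \<ge> 0"
    using roots by (auto simp: as_def)
  ultimately show thesis
    using that[of "lead_coeff p" as] assms(1) by simp
qed

lemma Re_sum_list: "Re (sum_list xs) = sum_list (map Re xs)"
  by (induction xs) auto

lemma Im_sum_list: "Im (sum_list xs) = sum_list (map Im xs)"
  by (induction xs) auto

lemma sum_list_neg:
  fixes f :: "'a \<Rightarrow> real"
  assumes "xs \<noteq> []" "\<And>x. x \<in> set xs \<Longrightarrow> f x < 0"
  shows "(\<Sum>x\<leftarrow>xs. f x) < 0"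
  using assms by (induction xs rule: list_nonempty_induct) (auto intro: add_neg_neg)

lemma one_add_sum_inverse_eq_0_imp_nonpos_real:
  assumes nonneg: "\<forall>a\<in>set as. a \<ge> 0" and eq: "1 + (\<Sum>a\<leftarrow>as. 1 / (z + of_real a)) = 0"
  shows "z \<in> \<real> \<and> Re z \<le> 0"
proof
  have ne: "as \<noteq> []"
    using eq by auto
  show "z \<in> \<real>"
  proof (rule ccontr)
    assume "z \<notin> \<real>"
    then have "Im z \<noteq> 0"
      by (simp add: complex_is_Real_iff)
    \<comment> \<open>The product is \<open>- (Im z)^2 / |z + a|^2\<close>; the factor
      \<open>Im z\<close> treats both half-planes at once.\<close>
    then have "Im z * Im (1 / (z + of_real a)) < 0" for a :: real
      by (simp add: Im_divide divide_pos_pos add_nonneg_pos flip: power2_eq_square)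
    then have "(\<Sum>a\<leftarrow>as. Im z * Im (1 / (z + of_real a))) < 0"
      by (intro sum_list_neg ne)
    moreover have "(\<Sum>a\<leftarrow>as. Im (1 / (z + of_real a))) = 0"
      using arg_cong[OF eq, of Im] by (simp add: Im_sum_list o_def)
    ultimately show False
      by (simp add: sum_list_const_mult)
  qed
  show "Re z \<le> 0"
  proof (rule ccontr)
    assume "\<not> Re z \<le> 0"
    \<comment> \<open>Each term has nonnegative real part, so the real part of the whole expression
      would be at least 1.\<close>
    then have "Re (1 / (z + of_real a)) \<ge> 0" if "a \<in> set as" for a
      using nonneg that by (auto simp: Re_divide intro!: divide_nonneg_nonneg)
    then have "0 \<le> (\<Sum>a\<leftarrow>as. Re (1 / (z + of_real a)))"
      by (intro sum_list_nonneg) auto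
    then show False
      using arg_cong[OF eq, of Re] by (simp add: Re_sum_list o_def)
  qed
qed

text \<open>Differentiation lowers the degree, so adding the derivative keeps the leading
  coefficient.\<close>

lemma bell_poly_nonzero: "bell_poly k \<noteq> 0"
proof (induction k)
  case (Suc k)
  have "bell_poly k + pderiv (bell_poly k) \<noteq> 0"
  proof
    assume eq: "bell_poly k + pderiv (bell_poly k) = 0"
    have "coeff (bell_poly k + pderiv (bell_poly k)) (degree (bell_poly k)) = lead_coeff (bell_poly k)"
      by (simp add: coeff_pderiv coeff_eq_0)
    with eq Suc show False
      by simp
  qed
  then show ?case
    by simp
qed simp

lemma bell_poly_roots: "poly (bell_poly k) z = 0 \<Longrightarrow> z \<in> \<real> \<and> Re z \<le> 0"
proof (induction k arbitrary: z)
  case (Suc k)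
  obtain c as where as: "c \<noteq> 0" "\<forall>a\<in>set as. a \<ge> 0" "bell_poly k = real_roots_poly c as"
    using real_roots_poly_exhaust[OF bell_poly_nonzero Suc.IH] by blast
  show ?case
  \<comment> \<open>The root 0 comes from the factor x and common roots fall to the induction
    hypothesis; elsewhere \<open>f + f' = f (1 + f' / f)\<close> may be used.\<close>
  proof (cases "z = 0 \<or> poly (bell_poly k) z = 0")
    case True
    then show ?thesis
      using Suc.IH by auto
  next
    case False
    then have nz: "poly (real_roots_poly c as) z \<noteq> 0"
      by (simp add: as)
    have "poly (real_roots_poly c as) z * (1 + (\<Sum>a\<leftarrow>as. 1 / (z + of_real a))) = 0"
      using Suc.prems False unfolding distrib_left
      by (simp add: as poly_pderiv_real_roots_poly[OF nz] flip: distrib_left[of z])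
    then have "1 + (\<Sum>a\<leftarrow>as. 1 / (z + of_real a)) = 0"
      using nz by simp
    then show ?thesis
      by (rule one_add_sum_inverse_eq_0_imp_nonpos_real[OF as(2)])
  qed
qed simp

lemma one_add_sum_divide_square_nonzero:
  assumes z: "Re z > 0" and nonneg: "\<forall>a\<in>set as. a \<ge> 0"
  shows "1 + (\<Sum>a\<leftarrow>as. of_real a / (z + of_real a)\<^sup>2) \<noteq> 0"
proof
  \<comment> \<open>A convex cone that contains every summand but not \<open>-1\<close>.\<close>
  define K where "K = {t. Im z * Im t < 0 \<or> Im t = 0 \<and> Re t \<ge> 0}"
  have K_add: "s + t \<in> K" if "s \<in> K" "t \<in> K" for s t
    using that by (auto simp: K_def distrib_left)
  have K_summand: "of_real a / (z + of_real a)\<^sup>2 \<in> K" if "a \<ge> 0" for a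
  proof (cases "a = 0 \<or> Im z = 0")
    case True
    then show ?thesis
      using \<open>a \<ge> 0\<close> by (auto simp: K_def Re_divide Im_divide power2_eq_square)
  next
    case False
    let ?w = "z + of_real a"
    have "?w \<noteq> 0"
      using False by (auto simp: complex_eq_iff)
    have "Im (of_real a / ?w\<^sup>2) = - (a * Im (?w\<^sup>2)) / (cmod (?w\<^sup>2))\<^sup>2"
      by (simp add: Im_divide cmod_power2)
    \<comment> \<open>Here \<open>Re z > 0\<close> enters: since \<open>Re z + a > 0\<close>, the
      square stays on the same side of the real axis as \<open>z\<close>.\<close>
    also have "Im (?w\<^sup>2) = 2 * (Re z + a) * Im z"
      by (simp add: power2_eq_square)
    finally have "Im z * Im (of_real a / ?w\<^sup>2) =
        - (2 * a * (Re z + a) * (Im z)\<^sup>2 / (cmod (?w\<^sup>2))\<^sup>2)"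
      by (simp add: power2_eq_square ac_simps)
    also have "\<dots> < 0"
      using z False \<open>a \<ge> 0\<close> \<open>?w \<noteq> 0\<close> by simp
    finally show ?thesis
      by (simp add: K_def)
  qed
  have "(\<Sum>a\<leftarrow>as. of_real a / (z + of_real a)\<^sup>2) \<in> K"
    using nonneg
  proof (induction as)
    case (Cons a as)
    then show ?case
      using K_add[OF K_summand[of a]] by simp
  qed (simp add: K_def)
  moreover assume "1 + (\<Sum>a\<leftarrow>as. of_real a / (z + of_real a)\<^sup>2) = 0"
  then have "(\<Sum>a\<leftarrow>as. of_real a / (z + of_real a)\<^sup>2) = - 1"
    by (simp add: add_eq_0_iff)
  ultimately show False
    by (simp add: K_def)
qed

theorem mainTheorem2:
  fixes k :: nat
  shows "weakly_hurwitz_stable (turan bell_poly k)"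
  unfolding weakly_hurwitz_stable_def
proof (intro allI impI)
  fix z :: complex
  assume z: "Re z > 0"
  define f where "f = bell_poly k"
  obtain c as where as: "c \<noteq> 0" "\<forall>a\<in>set as. a \<ge> 0" "f = real_roots_poly c as"
    unfolding f_def using real_roots_poly_exhaust[OF bell_poly_nonzero bell_poly_roots[of k]] .
  have nz: "poly f z \<noteq> 0"
    using bell_poly_roots[of k z] z by (auto simp: f_def)
  have z_add: "z + of_real a \<noteq> 0" if "a \<in> set as" for a
    using nz that by (auto simp: as poly_real_roots_poly_eq_0_iff)
  let ?S1 = "\<Sum>a\<leftarrow>as. 1 / (z + of_real a)" and ?S2 = "\<Sum>a\<leftarrow>as. 1 / (z + of_real a)\<^sup>2"
  \<comment> \<open>Two steps of the recurrence express everything by \<open>f\<close>,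
    \<open>f'\<close> and \<open>f''\<close>; the terms \<open>z^2 f^2\<close> and
    \<open>2 z^2 f f'\<close> cancel, leaving a Laguerre expression.\<close>
  have "poly (turan bell_poly k) z =
      z\<^sup>2 * ((poly (pderiv f) z)\<^sup>2 - poly f z * poly (pderiv (pderiv f)) z)
      - z * poly f z * (poly f z + poly (pderiv f) z)"
    by (simp add: turan_def pderiv_mult pderiv_add pderiv_pCons flip: f_def)
      (simp add: power2_eq_square algebra_simps)
  also have "\<dots> = - z * (poly f z)\<^sup>2 * (1 + (?S1 - z * ?S2))"
    unfolding as poly_laguerre_real_roots_poly[OF nz[unfolded as]]
    unfolding poly_pderiv_real_roots_poly[OF nz[unfolded as]]
    by (simp add: power2_eq_square algebra_simps)
  \<comment> \<open>Termwise, \<open>1 / w - z / w^2 = a / w^2\<close> for \<open>w = z + a\<close>,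
    which produces the sum already known to differ from -1.\<close>
  also have "?S1 - z * ?S2 = (\<Sum>a\<leftarrow>as. 1 / (z + of_real a) - z * (1 / (z + of_real a)\<^sup>2))"
    by (simp only: sum_list_subtractf sum_list_const_mult)
  also have "\<dots> = (\<Sum>a\<leftarrow>as. of_real a / (z + of_real a)\<^sup>2)"
  proof (intro arg_cong[of _ _ sum_list] map_cong refl)
    fix a
    assume "a \<in> set as"
    then have "1 / (z + of_real a) = (z + of_real a) / (z + of_real a)\<^sup>2"
      using z_add by (simp add: power2_eq_square)
    then show "1 / (z + of_real a) - z * (1 / (z + of_real a)\<^sup>2) = of_real a / (z + of_real a)\<^sup>2"
      by (simp add: add_divide_distrib)
  qed
  finally show "poly (turan bell_poly k) z \<noteq> 0"
    using z nz one_add_sum_divide_square_nonzero[OF z as(2)] by auto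
qed

end
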